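(* Let $s\ge0$ be an integer, write $s=k(k+1)+i$ with integers $k\ge0$ and $0\le i\le 2k+1$, and define \[ (x^{even}_s,y^{even}_s)=\begin{cases}(i,\,2(k-i)),&0\le i\le k,\\ (i-k-1,\,4k-2i+3),&k+1\le i\le 2k+1,\end{cases}\qquad (x^{odd}_s,y^{odd}_s)=\begin{cases}(2i,\,k-i),&0\le i\le k,\\ (2(i-k)-1,\,2k-i+1),&k+1\le i\le 2k+1,\end{cases} \] and $N^{even}_s=6\lfloor\sqrt{s+1}\rfloor-6$, $N^{odd}_s=6\left\lfloor\frac{\sqrt{4s+5}-1}{2}\right\rfloor-3$. Let $\mathbb{B}=\{m\in\mathbb{N}: m=j^2\text{ or } m=j(j+1)\text{ for some integer } j\ge1\}$ and $t_m=\frac{m(m+1)}{2}$. If $s\in\{0,1,2\}$ or $s\notin\mathbb{B}$, then for every integer $n\ge2$: \[ \mathtt{g}(t_n,t_{n+1},t_{n+2};s)=\begin{cases}\frac{(n+1)(n+2)}{4}\Big((2x^{even}_s+y^{even}_s+3)n+6x^{even}_s\Big)-1,&\text{if } n \text{ is even and } n>N^{even}_s,\\[3pt] \frac{(n+1)(n+2)}{4}\Big((x^{odd}_s+2y^{odd}_s+3)n+3(x^{odd}_s-1)\Big)-1,&\text{if } n \text{ is odd and } n>N^{odd}_s.\end{cases} \]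
   Context: For positive integers $a_1,\dots,a_k$ with $\gcd(a_1,\dots,a_k)=1$ and an integer $m\ge 0$, $\operatorname{d}(m;a_1,\dots,a_k)$ denotes the number of tuples of non-negative integers $(x_1,\dots,x_k)$ with $a_1x_1+\dots+a_kx_k=m$. For an integer $s\ge0$, $\mathtt{g}(a_1,\dots,a_k;s)=\max\{m\in\mathbb{Z}:\operatorname{d}(m;a_1,\dots,a_k)\le s\}$ (generalized Frobenius number). *)

theory Defs
  imports Complex_Main "HOL-Library.Nat_Bijection"
begin

text \<open>
  Tuples are lists of the same length as the list of generators. The argument \<open>m\<close> is an
  integer because the generalized Frobenius number is a maximum over all integers;
  for \<open>m < 0\<close> there are no representations and the count is 0.
  The notion is meant for lists of positive integers with gcd 1; if some entry
  is 0, the set can be infinite and \<open>card\<close> is then 0.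
\<close>

definition denumerant :: "int \<Rightarrow> nat list \<Rightarrow> nat" where
  "denumerant m as =
     card {xs :: nat list. length xs = length as \<and> int (\<Sum>j<length as. as ! j * xs ! j) = m}"

text \<open>
  The set \<open>{m. denumerant m as \<le> s}\<close> contains all negative integers, so it is infinite and
  the operator \<open>Max\<close> for finite sets does not apply; \<open>GREATEST\<close> denotes its maximum (which
  exists for nonempty lists of positive integers with gcd 1). For \<open>1 \<in> set as\<close> the value
  can be negative.
\<close>

definition gen_frobenius :: "nat list \<Rightarrow> nat \<Rightarrow> int" where
  "gen_frobenius as s = (GREATEST m :: int. denumerant m as \<le> s)"

text \<open>
  The pairs attached to \<open>s = k(k+1) + i\<close>, \<open>0 \<le> i \<le> 2k+1\<close>, as functions of \<open>k\<close> and \<open>i\<close>,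
  which \<open>s\<close> determines uniquely.
\<close>

definition xy_even :: "nat \<Rightarrow> nat \<Rightarrow> int \<times> int" where
  "xy_even k i =
     (if i \<le> k then (int i, 2 * (int k - int i))
      else (int i - int k - 1, 4 * int k - 2 * int i + 3))"

definition xy_odd :: "nat \<Rightarrow> nat \<Rightarrow> int \<times> int" where
  "xy_odd k i =
     (if i \<le> k then (2 * int i, int k - int i)
      else (2 * (int i - int k) - 1, 2 * int k - int i + 1))"

definition N_even :: "nat \<Rightarrow> int" where
  "N_even s = 6 * \<lfloor>sqrt (real s + 1)\<rfloor> - 6"

definition N_odd :: "nat \<Rightarrow> int" where
  "N_odd s = 6 * \<lfloor>(sqrt (4 * real s + 5) - 1) / 2\<rfloor> - 3"

definition exceptional_set :: "nat set" where
  "exceptional_set = {m. \<exists>j\<ge>1. m = j ^ 2 \<or> m = j * (j + 1)}"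

end

theory Submission
  imports Defs
begin

text \<open>
  For \<open>n = 2m\<close> and \<open>n = 2m + 1\<close> the three triangular numbers have the shape \<open>pb\<close>, \<open>pq\<close>, \<open>qc\<close> with
  \<open>pb\<close> coprime to \<open>q\<close> and \<open>qc\<close> coprime to \<open>p\<close>. In a representation \<open>M = pb x + pq y + qc z\<close> the
  residues \<open>x0\<close> of \<open>x\<close> mod \<open>q\<close> and \<open>z0\<close> of \<open>z\<close> mod \<open>p\<close> are determined by \<open>M\<close>, so with
  \<open>M = pb x0 + qc z0 + pq K\<close> the number of representations is the number of lattice points
  \<open>x, z \<ge> 0\<close> with \<open>b x + c z \<le> K\<close>. Hence the Frobenius number is
  \<open>pb (q - 1) + qc (p - 1) + pq (L - 1)\<close>, where \<open>L\<close> is the \<open>(s + 1)\<close>-st smallest value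
  of \<open>b x + c z\<close>. One of \<open>b, c\<close> is about twice the other, and the bound on \<open>n\<close> ensures that
  the values around the \<open>(s + 1)\<close>-st one are sorted first by the level \<open>x + 2z\<close> (or \<open>2x + z\<close>), which has
  \<open>\<lfloor>w/2\<rfloor> + 1\<close> points for level \<open>w\<close>.
\<close>

section \<open>Representations as lattice points\<close>

text \<open>\<open>K\<close> is an integer because splitting off the residues of \<open>x\<close>
  and \<open>z\<close> can leave a negative quotient; the set is then empty.\<close>

definition points :: "nat \<Rightarrow> nat \<Rightarrow> int \<Rightarrow> (nat \<times> nat) set" where
  "points b c K = {(x, z). int (b * x + c * z) \<le> K}"

lemma finite_points:
  assumes "b > 0" "c > 0"
  shows "finite (points b c K)"
proof (rule finite_subset)
  show "points b c K \<subseteq> {..nat K} \<times> {..nat K}"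
  proof (clarsimp simp: points_def)
    fix x z assume h: "int b * int x + int c * int z \<le> K"
    have "x \<le> b * x" "z \<le> c * z" using assms by auto
    then have "int x \<le> int b * int x" "int z \<le> int c * int z"
      by (metis of_nat_le_iff of_nat_mult)+
    then show "x \<le> nat K \<and> z \<le> nat K" using h
      by (smt (verit) nat_int nat_mono of_nat_0_le_iff)
  qed
qed simp

lemma card_points_mono:
  assumes "b > 0" "c > 0" "K \<le> K'"
  shows "card (points b c K) \<le> card (points b c K')"
  using assms by (intro card_mono finite_points) (auto simp: points_def)

lemma card_points_swap: "card (points b c K) = card (points c b K)"
proof -
  have "points b c K = prod.swap ` points c b K"
    by (auto simp: points_def image_iff algebra_simps)
  then show ?thesis by (metis card_image inj_swap)
qed

text \<open>Writing x = x0 + q x' and z = z0 + p z' and dividing by pq leaves b x' + c z' + y = K.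
  So y is the slack of the inequality b x' + c z' \<le> K, and the map \<open>f\<close> restores the
  full triple from the lattice point.\<close>

lemma denumerant_eq_card_points:
  fixes p q b c x0 z0 :: nat and K :: int
  assumes "p > 0" "q > 0" "coprime (p * b) q" "coprime (q * c) p" "x0 < q" "z0 < p"
    and M: "M = int (p * b * x0) + int (q * c * z0) + int (p * q) * K"
  shows "denumerant M [p * b, p * q, q * c] = card (points b c K)"
proof -
  define f where "f = (\<lambda>(x, z). [x0 + q * x, nat (K - int (b * x + c * z)), z0 + p * z])"
  define R where "R = {xs :: nat list. length xs = length [p * b, p * q, q * c] \<and>
      int (\<Sum>j<length [p * b, p * q, q * c]. [p * b, p * q, q * c] ! j * xs ! j) = M}"
  have R_iff: "[x, y, z] \<in> R \<longleftrightarrow> int (p * b * x + p * q * y + q * c * z) = M" for x y z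
    unfolding R_def by (simp add: numeral_3_eq_3 numeral_2_eq_2 lessThan_Suc algebra_simps)
  have inj: "inj_on f (points b c K)"
    using assms by (auto simp: inj_on_def f_def)
  have "f ` points b c K = R"
  proof (intro equalityI subsetI)
    fix xs assume "xs \<in> f ` points b c K"
    then obtain x z where xz: "int (b * x + c * z) \<le> K" "xs = f (x, z)"
      by (auto simp: points_def)
    define y where "y = nat (K - int (b * x + c * z))"
    have "K = int (b * x + c * z) + int y"
      using xz(1) by (simp add: y_def)
    then have "[x0 + q * x, y, z0 + p * z] \<in> R"
      unfolding R_iff M by (simp add: algebra_simps)
    then show "xs \<in> R" by (simp add: xz f_def y_def)
  next
    fix xs assume xs: "xs \<in> R"
    then obtain x y z where xs_eq: "xs = [x, y, z]"
      by (auto simp: R_def length_Suc_conv numeral_3_eq_3)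
    have eq: "int (p * b) * int x + int (p * q) * int y + int (q * c) * int z = M"
      using xs unfolding xs_eq R_iff by simp
    have "int (p * b) * (int x - int x0) = int q * (int c * int z0 + int p * K - int p * int y - int c * int z)"
      using eq unfolding M by (simp add: algebra_simps)
    then have "int q dvd int (p * b) * (int x - int x0)" by simp
    then have "int q dvd int x - int x0"
      using assms(3) by (metis coprime_commute coprime_dvd_mult_right_iff coprime_int_iff)
    then have "int x mod int q = int x0 mod int q" by (simp add: mod_eq_dvd_iff)
    then have "x mod q = x0" using \<open>x0 < q\<close> by (metis mod_less of_nat_eq_iff of_nat_mod)
    then obtain x' where x': "x = x0 + q * x'" by (metis mod_mult_div_eq)
    have "int (q * c) * (int z - int z0) = int p * (int b * int x0 + int q * K - int q * int y - int b * int x)"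
      using eq unfolding M by (simp add: algebra_simps)
    then have "int p dvd int (q * c) * (int z - int z0)" by simp
    then have "int p dvd int z - int z0"
      using assms(4) by (metis coprime_commute coprime_dvd_mult_right_iff coprime_int_iff)
    then have "int z mod int p = int z0 mod int p" by (simp add: mod_eq_dvd_iff)
    then have "z mod p = z0" using \<open>z0 < p\<close> by (metis mod_less of_nat_eq_iff of_nat_mod)
    then obtain z' where z': "z = z0 + p * z'" by (metis mod_mult_div_eq)
    have "int (p * q) * (int (b * x' + c * z') + int y) = int (p * q) * K"
      using eq unfolding M x' z' by (simp add: algebra_simps)
    then have K: "int (b * x' + c * z') + int y = K"
      using assms(1,2) by simp
    then have "(x', z') \<in> points b c K" "xs = f (x', z')"
      by (auto simp: points_def f_def xs_eq x' z')
    then show "xs \<in> f ` points b c K" by blast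
  qed
  then show ?thesis
    using card_image[OF inj] by (simp add: denumerant_def R_def)
qed

text \<open>The two residues solve separate congruences, mod q and mod p. What remains of M is then
  divisible by both p and q, hence by pq, since these are coprime.\<close>

lemma reduced_residues_exist:
  fixes p q b c :: nat and M :: int
  assumes "p > 0" "q > 0" "coprime (p * b) q" "coprime (q * c) p"
  obtains x0 z0 :: nat and K :: int
  where "x0 < q" "z0 < p" "M = int (p * b * x0) + int (q * c * z0) + int (p * q) * K"
proof -
  \<comment> \<open>The witness is M times the Bezout inverse of \<open>a\<close> modulo
    \<open>r\<close>, reduced modulo \<open>r\<close>.\<close>
  have solve: "\<exists>x0 < r. int r dvd M - int a * int x0" if "r > 0" "coprime a r" for a r :: nat
  proof -
    have "coprime (int a) (int r)" using that by simp
    then obtain u v where uv: "u * int a + v * int r = 1"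
      using bezout_int[of "int a" "int r"] by auto
    define x0 where "x0 = nat (u * M mod int r)"
    have x0: "int x0 = u * M mod int r" using that by (simp add: x0_def)
    have "M - int a * (u * M) = int r * (v * M)"
      using arg_cong[OF uv, of "\<lambda>t. t * M"] by (simp add: algebra_simps)
    then have "int r dvd M - int a * (u * M)" by simp
    moreover have "int r dvd int a * (u * M) - int a * int x0"
      unfolding x0 by (metis dvd_minus_mod dvd_mult right_diff_distrib)
    ultimately have "int r dvd M - int a * int x0"
      by (metis (no_types, lifting) diff_add_cancel diff_diff_eq2 dvd_add add_diff_eq)
    moreover have "x0 < r" using that x0 by (metis of_nat_less_iff of_nat_0_less_iff pos_mod_bound)
    ultimately show ?thesis by blast
  qed
  obtain x0 where x0: "x0 < q" "int q dvd M - int (p * b) * int x0"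
    using solve[of q "p * b"] assms by auto
  obtain z0 where z0: "z0 < p" "int p dvd M - int (q * c) * int z0"
    using solve[of p "q * c"] assms by auto
  let ?D = "M - int (p * b) * int x0 - int (q * c) * int z0"
  have "int q dvd ?D" using x0(2) by (simp add: dvd_diff)
  moreover have "?D = (M - int (q * c) * int z0) - int p * (int b * int x0)" by simp
  then have "int p dvd ?D" using z0(2) by (metis dvd_diff dvd_triv_left)
  moreover have "coprime (int p) (int q)" using assms(3) by simp
  ultimately have "int p * int q dvd ?D" by (simp add: divides_mult)
  then obtain K where "?D = int p * int q * K" by (elim dvdE)
  then show ?thesis using that[of x0 z0 K] x0(1) z0(1) by simp
qed

text \<open>The candidate has the largest residues q - 1 and p - 1 with quotient L - 1. Any larger M
  has residues no larger than these, so its quotient is at least L and its count exceeds s by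
  monotonicity in K.\<close>

lemma gen_frobenius_eqI:
  fixes p q b c L s :: nat
  assumes pos: "p > 0" "q > 0" "b > 0" "c > 0"
    and cop: "coprime (p * b) q" "coprime (q * c) p"
    and below: "card (points b c (int L - 1)) \<le> s"
    and above: "s < card (points b c (int L))"
  shows "gen_frobenius [p * b, p * q, q * c] s =
    int p * int b * (int q - 1) + int q * int c * (int p - 1) + int p * int q * (int L - 1)"
    (is "_ = ?g")
  unfolding gen_frobenius_def
proof (rule Greatest_equality)
  have "?g = int (p * b * (q - 1)) + int (q * c * (p - 1)) + int (p * q) * (int L - 1)"
    using pos by (simp add: of_nat_diff)
  then show "denumerant ?g [p * b, p * q, q * c] \<le> s"
    using denumerant_eq_card_points[of p q b c "q - 1" "p - 1" ?g "int L - 1"] pos cop below by simp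
next
  fix M assume M: "denumerant M [p * b, p * q, q * c] \<le> s"
  show "M \<le> ?g"
  proof (rule ccontr)
    assume "\<not> M \<le> ?g"
    obtain x0 z0 K where *: "x0 < q" "z0 < p"
        "M = int (p * b * x0) + int (q * c * z0) + int (p * q) * K"
      using reduced_residues_exist[OF pos(1,2) cop] by blast
    have "int p * int b * int x0 \<le> int p * int b * (int q - 1)"
      using *(1) by (intro mult_left_mono) auto
    moreover have "int q * int c * int z0 \<le> int q * int c * (int p - 1)"
      using *(2) by (intro mult_left_mono) auto
    ultimately have "int p * int q * (int L - 1) < int p * int q * K"
      using \<open>\<not> M \<le> ?g\<close> *(3) by simp
    then have "int L - 1 < K" using pos by (simp add: mult_less_cancel_left)
    then have "card (points b c (int L)) \<le> card (points b c K)"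
      using pos by (intro card_points_mono) auto
    then show False
      using denumerant_eq_card_points[OF pos(1,2) cop *] M above by simp
  qed
qed

section \<open>Counting lattice points by levels\<close>

text \<open>On the level x + 2z = w a point is determined by z, so \<open>A\<close> selects the part
  of the top level that is included.\<close>

definition lower_levels :: "nat \<Rightarrow> nat set \<Rightarrow> (nat \<times> nat) set" where
  "lower_levels w A = {(x, z). x + 2 * z < w \<or> (x + 2 * z = w \<and> z \<in> A)}"

lemma card_lower_levels:
  assumes "A \<subseteq> {..w div 2}"
  shows "finite (lower_levels w A)"
    and "card (lower_levels w A) = (\<Sum>v<w. v div 2 + 1) + card A"
proof -
  \<comment> \<open>Coordinates (level, z) turn the set into a disjoint union of fibres. By
    \<open>le\<close> the natural subtraction in \<open>f\<close> is exact on
    \<open>S\<close>.\<close>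
  define S where "S = Sigma {..<w} (\<lambda>v. {..v div 2}) \<union> {w} \<times> A"
  define f where "f = (\<lambda>(v, z :: nat). (v - 2 * z, z))"
  have finA: "finite A" using assms finite_subset by blast
  have le: "2 * z \<le> v" if "(v, z) \<in> S" for v z
    using that assms by (auto simp: S_def)
  have "inj_on f S"
    by (rule inj_onI) (auto simp: f_def dest!: le)
  moreover have "f ` S = lower_levels w A"
  proof (intro equalityI subsetI)
    fix t assume "t \<in> f ` S"
    then obtain v z where "(v, z) \<in> S" "t = (v - 2 * z, z)" by (auto simp: f_def)
    then show "t \<in> lower_levels w A" using le[of v z] by (auto simp: S_def lower_levels_def)
  next
    fix t assume "t \<in> lower_levels w A"
    then obtain x z where "t = f (x + 2 * z, z)" "(x + 2 * z, z) \<in> S"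
      by (auto simp: S_def f_def lower_levels_def)
    then show "t \<in> f ` S" by blast
  qed
  moreover have "finite S" using finA by (auto simp: S_def)
  moreover have "card S = (\<Sum>v<w. v div 2 + 1) + card A"
    unfolding S_def using finA
    by (subst card_Un_disjoint) (auto simp: card_cartesian_product)
  ultimately show "finite (lower_levels w A)"
    and "card (lower_levels w A) = (\<Sum>v<w. v div 2 + 1) + card A"
    by (metis finite_imageI, metis card_image)
qed

lemma sum_level_sizes:
  fixes k :: nat
  shows "(\<Sum>v<2 * k. v div 2 + 1) = k * (k + 1)"
  "(\<Sum>v<2 * k + 1. v div 2 + 1) = k * (k + 1) + k + 1"
proof -
  show *: "(\<Sum>v<2 * k. v div 2 + 1) = k * (k + 1)"
    by (induction k) auto
  show "(\<Sum>v<2 * k + 1. v div 2 + 1) = k * (k + 1) + k + 1"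
    using * by simp
qed

text \<open>All points of value below L lie in a set of s points, while some s + 1 points have value
  at most L. This makes L the (s + 1)-st smallest value, with ties allowed.\<close>

lemma card_points_sandwich:
  assumes pos: "b > 0" "c > 0"
    and A: "A \<subseteq> {..w div 2}" "B \<subseteq> {..w div 2}"
    and card: "(\<Sum>v<w. v div 2 + 1) + card A = s" "card B = card A + 1"
    and below: "\<And>x z. b * x + c * z < L \<Longrightarrow> (x, z) \<in> lower_levels w A"
    and above: "\<And>x z. (x, z) \<in> lower_levels w B \<Longrightarrow> b * x + c * z \<le> L"
  shows "card (points b c (int L - 1)) \<le> s" "s < card (points b c (int L))"
proof -
  \<comment> \<open>The threshold stays in the integers because L = 0 is possible.\<close>
  have "int y \<le> int L - 1 \<longleftrightarrow> y < L" for y :: nat by auto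
  then have "points b c (int L - 1) \<subseteq> lower_levels w A"
    using below unfolding points_def by blast
  then show "card (points b c (int L - 1)) \<le> s"
    using card_lower_levels[OF A(1)] card(1) by (metis card_mono)
  have "lower_levels w B \<subseteq> points b c (int L)"
    using above by (auto simp: points_def simp flip: of_nat_mult of_nat_add)
  then have "card (lower_levels w B) \<le> card (points b c (int L))"
    using finite_points[OF pos] by (metis card_mono)
  then show "s < card (points b c (int L))"
    using card_lower_levels(2)[OF A(2)] card by simp
qed

text \<open>The value m(x + 2z) + 3z grows with z inside a level, so the (s + 1)-st point is z = a
  on level w. \<open>h1\<close> keeps level w + 1 from starting below its value, \<open>h2\<close>
  keeps level w - 1 from ending above it.\<close>

lemma card_points_lower:
  fixes m w a s :: nat
  assumes "m > 0" and a: "a \<le> w div 2"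
    and s: "s = (\<Sum>v<w. v div 2 + 1) + a"
    and h1: "3 * a \<le> m" and h2: "3 * ((w - 1) div 2) \<le> m + 3 * a"
  shows "card (points m (2 * m + 3) (int (m * w + 3 * a) - 1)) \<le> s"
    "s < card (points m (2 * m + 3) (int (m * w + 3 * a)))"
proof -
  have val: "m * x + (2 * m + 3) * z = m * (x + 2 * z) + 3 * z" for x z
    by (simp add: algebra_simps)
  have below: "(x, z) \<in> lower_levels w {..<a}"
    if "m * x + (2 * m + 3) * z < m * w + 3 * a" for x z
  proof (cases "x + 2 * z > w")
    case True
    then have "m * (w + 1) \<le> m * (x + 2 * z)" by (intro mult_le_mono2) simp
    then show ?thesis using that h1 unfolding val by simp
  next
    case False
    then show ?thesis
      using that unfolding val by (cases "x + 2 * z = w") (auto simp: lower_levels_def)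
  qed
  have above: "m * x + (2 * m + 3) * z \<le> m * w + 3 * a"
    if "(x, z) \<in> lower_levels w {..a}" for x z
  proof (cases "x + 2 * z < w")
    case True
    then have "m * (x + 2 * z) \<le> m * (w - 1)" by (intro mult_le_mono2) simp
    moreover have "z \<le> (w - 1) div 2" using True by linarith
    moreover have "m * (w - 1) + m = m * w" using True by (cases w) auto
    ultimately show ?thesis using h2 unfolding val by linarith
  next
    case False
    then show ?thesis using that unfolding val by (auto simp: lower_levels_def)
  qed
  have sub: "{..<a} \<subseteq> {..w div 2}" "{..a} \<subseteq> {..w div 2}" using a by auto
  have cards: "(\<Sum>v<w. v div 2 + 1) + card {..<a} = s" "card {..a} = card {..<a} + 1"
    using s by simp_all
  show "card (points m (2 * m + 3) (int (m * w + 3 * a) - 1)) \<le> s"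
    "s < card (points m (2 * m + 3) (int (m * w + 3 * a)))"
    using card_points_sandwich[OF \<open>m > 0\<close> _ sub cards below above] by simp_all
qed

text \<open>Here the value h(x + 2z) - 3z falls as z grows inside a level, so the point z = a on
  level w comes after the w div 2 - a points with larger z. \<open>h1\<close> bounds the lower
  levels, \<open>h2\<close> the smallest value on level w + 1.\<close>

lemma card_points_upper:
  fixes h w a s :: nat
  assumes "h \<ge> 3" and a: "a \<le> w div 2"
    and s: "s = (\<Sum>v<w. v div 2 + 1) + (w div 2 - a)"
    and h1: "3 * a \<le> h" and h2: "3 * ((w + 1) div 2) \<le> h + 3 * a"
  shows "card (points h (2 * h - 3) (int (h * w - 3 * a) - 1)) \<le> s"
    "s < card (points h (2 * h - 3) (int (h * w - 3 * a)))"
proof -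
  have val: "h * x + (2 * h - 3) * z + 3 * z = h * (x + 2 * z)" for x z
  proof -
    have "(2 * h - 3) * z + 3 * z = 2 * h * z"
      using assms(1) by (metis add_mult_distrib le_add_diff_inverse2 le_trans mult_2 le_add1)
    then show ?thesis by (simp add: algebra_simps)
  qed
  have "3 * a \<le> 3 * w" using a by auto
  also have "3 * w \<le> h * w" using assms(1) by simp
  finally have aw: "3 * a \<le> h * w" .
  have below: "(x, z) \<in> lower_levels w {a<..w div 2}"
    if "h * x + (2 * h - 3) * z < h * w - 3 * a" for x z
  proof (cases "x + 2 * z > w")
    case True
    then obtain j where j: "x + 2 * z = w + 1 + j"
      by (metis Suc_eq_plus1 less_iff_Suc_add add.assoc add.commute)
    \<comment> \<open>Each further level adds h to h(x + 2z) but at most 3 to the bound on 3z, so h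
      \<ge> 3 reduces all higher levels to level w + 1.\<close>
    then have "3 * z \<le> 3 * ((w + 1) div 2) + 3 * j" by presburger
    also have "\<dots> \<le> h + 3 * a + h * j"
      using h2 assms(1) by (intro add_mono mult_le_mono1) auto
    finally have "3 * z \<le> h + 3 * a + h * j" .
    moreover have "h * (x + 2 * z) = h * w + h + h * j"
      unfolding j by (simp add: algebra_simps)
    ultimately show ?thesis using that val[of x z] by linarith
  next
    case False
    then show ?thesis
      using that val[of x z] by (cases "x + 2 * z = w") (auto simp: lower_levels_def)
  qed
  have above: "h * x + (2 * h - 3) * z \<le> h * w - 3 * a"
    if "(x, z) \<in> lower_levels w {a..w div 2}" for x z
  proof (cases "x + 2 * z < w")
    case True
    then have "h * (x + 2 * z + 1) \<le> h * w" by (intro mult_le_mono2) auto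
    then show ?thesis using h1 val[of x z] by simp
  next
    case False
    then have "x + 2 * z = w" "a \<le> z" using that by (auto simp: lower_levels_def)
    then show ?thesis using val[of x z] by simp
  qed
  have sub: "{a<..w div 2} \<subseteq> {..w div 2}" "{a..w div 2} \<subseteq> {..w div 2}" by auto
  have cards: "(\<Sum>v<w. v div 2 + 1) + card {a<..w div 2} = s"
    "card {a..w div 2} = card {a<..w div 2} + 1"
    using s a by simp_all
  show "card (points h (2 * h - 3) (int (h * w - 3 * a) - 1)) \<le> s"
    "s < card (points h (2 * h - 3) (int (h * w - 3 * a)))"
    using card_points_sandwich[OF _ _ sub cards below above] assms(1) by simp_all
qed

section \<open>Triangular triples for even and odd n\<close>

lemma triangle_even:
  fixes m :: nat
  shows "triangle (2 * m) = (2 * m + 1) * m"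
    "triangle (2 * m + 1) = (2 * m + 1) * (m + 1)"
    "triangle (2 * m + 2) = (m + 1) * (2 * m + 3)"
proof -
  have "2 * m * Suc (2 * m) = 2 * ((2 * m + 1) * m)"
    "(2 * m + 1) * Suc (2 * m + 1) = 2 * ((2 * m + 1) * (m + 1))"
    "(2 * m + 2) * Suc (2 * m + 2) = 2 * ((m + 1) * (2 * m + 3))"
    by (simp_all add: algebra_simps)
  then show "triangle (2 * m) = (2 * m + 1) * m"
    "triangle (2 * m + 1) = (2 * m + 1) * (m + 1)"
    "triangle (2 * m + 2) = (m + 1) * (2 * m + 3)"
    unfolding triangle_def by (metis nonzero_mult_div_cancel_left zero_neq_numeral)+
qed

lemma coprime_nat_lincombI:
  fixes a b :: nat and u v :: int
  assumes "u * int a + v * int b = 1"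
  shows "coprime a b"
proof -
  have "coprime (int a) (int b)"
  proof (rule coprimeI)
    fix d assume "d dvd int a" "d dvd int b"
    then have "d dvd u * int a + v * int b" by simp
    then show "is_unit d" using assms by simp
  qed
  then show ?thesis by simp
qed

text \<open>Take p = 2m + 1, q = m + 1, b = m, c = 2m + 3 = 2b + 3 and L = mw + 3a. The identity
  pb(q - 1) + qc(p - 1) - pq = 3mpq - 1 gives the closed form.\<close>

lemma gen_frobenius_triangle_even:
  fixes m w a s :: nat
  assumes "m > 0" "a \<le> w div 2" "s = (\<Sum>v<w. v div 2 + 1) + a"
    and "3 * a \<le> m" "3 * ((w - 1) div 2) \<le> m + 3 * a"
  shows "gen_frobenius [triangle (2 * m), triangle (2 * m + 1), triangle (2 * m + 2)] s =
    (2 * int m + 1) * (int m + 1) * (int m * int w + 3 * int a + 3 * int m) - 1"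
proof -
  have c1: "coprime (2 * m + 1) (m + 1)"
    by (rule coprime_nat_lincombI[of "-1" _ 2]) simp
  have c2: "coprime m (m + 1)"
    by (rule coprime_nat_lincombI[of "-1" _ 1]) simp
  have c3: "coprime (2 * m + 3) (2 * m + 1)"
    by (rule coprime_nat_lincombI[of "- int m" _ "int m + 1"]) (simp add: algebra_simps)
  have "gen_frobenius [(2 * m + 1) * m, (2 * m + 1) * (m + 1), (m + 1) * (2 * m + 3)] s =
     int (2 * m + 1) * int m * (int (m + 1) - 1) + int (m + 1) * int (2 * m + 3) * (int (2 * m + 1) - 1)
     + int (2 * m + 1) * int (m + 1) * (int (m * w + 3 * a) - 1)"
  proof (rule gen_frobenius_eqI)
    show "coprime ((2 * m + 1) * m) (m + 1)"
      using c1 c2 by (metis coprime_mult_left_iff coprime_commute)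
    show "coprime ((m + 1) * (2 * m + 3)) (2 * m + 1)"
      using c1 c3 by (metis coprime_mult_left_iff coprime_commute)
  qed (use assms(1) card_points_lower[OF assms] in simp_all)
  then show ?thesis
    unfolding triangle_even by (simp add: algebra_simps)
qed

lemma triangle_odd_plus_two:
  fixes m :: nat
  shows "triangle (2 * m + 1 + 2) = (2 * m + 3) * (m + 2)"
  using triangle_even(2)[of "m + 1"] by (simp add: algebra_simps)

text \<open>Take p = m + 1, q = 2m + 3, b = 2m + 1, c = m + 2. With h = c one has b = 2h - 3, so the
  coordinates are swapped to apply the decreasing case. Again pb(q - 1) + qc(p - 1) - pq = 3mpq -
  1.\<close>

lemma gen_frobenius_triangle_odd:
  fixes m w a s :: nat
  assumes "m > 0" "a \<le> w div 2" "s = (\<Sum>v<w. v div 2 + 1) + (w div 2 - a)"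
    and "3 * a \<le> m + 2" "3 * ((w + 1) div 2) \<le> m + 2 + 3 * a"
  shows "gen_frobenius [triangle (2 * m + 1), triangle (2 * m + 2), triangle (2 * m + 1 + 2)] s =
    (int m + 1) * (2 * int m + 3) * ((int m + 2) * int w - 3 * int a + 3 * int m) - 1"
proof -
  have c1: "coprime (m + 1) (2 * m + 3)"
    by (rule coprime_nat_lincombI[of "-2" _ 1]) simp
  have c2: "coprime (2 * m + 1) (2 * m + 3)"
    by (rule coprime_nat_lincombI[of "int m + 1" _ "- int m"]) (simp add: algebra_simps)
  have c3: "coprime (m + 2) (m + 1)"
    by (rule coprime_nat_lincombI[of "1" _ "-1"]) simp
  have "3 * a \<le> 3 * w" using assms(2) by auto
  also have "3 * w \<le> (m + 2) * w" using assms(1) by (intro mult_le_mono1) simp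
  finally have L: "int ((m + 2) * w - 3 * a) = (int m + 2) * int w - 3 * int a"
    by (simp add: of_nat_diff algebra_simps)
  have "2 * (m + 2) - 3 = 2 * m + 1" by simp
  then have cards:
    "card (points (2 * m + 1) (m + 2) (int ((m + 2) * w - 3 * a) - 1)) \<le> s"
    "s < card (points (2 * m + 1) (m + 2) (int ((m + 2) * w - 3 * a)))"
    using card_points_upper[of "m + 2" a w s] assms
    unfolding card_points_swap[of "2 * m + 1" "m + 2"] by auto
  have "gen_frobenius [(m + 1) * (2 * m + 1), (m + 1) * (2 * m + 3), (2 * m + 3) * (m + 2)] s =
     int (m + 1) * int (2 * m + 1) * (int (2 * m + 3) - 1)
     + int (2 * m + 3) * int (m + 2) * (int (m + 1) - 1)
     + int (m + 1) * int (2 * m + 3) * (int ((m + 2) * w - 3 * a) - 1)"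
  proof (rule gen_frobenius_eqI)
    show "coprime ((m + 1) * (2 * m + 1)) (2 * m + 3)"
      using c1 c2 by (metis coprime_mult_left_iff coprime_commute)
    show "coprime ((2 * m + 3) * (m + 2)) (m + 1)"
      using c1 c3 by (metis coprime_mult_left_iff coprime_commute)
  qed (use cards in simp_all)
  then show ?thesis
    unfolding triangle_even triangle_odd_plus_two L by (simp add: algebra_simps)
qed

section \<open>The thresholds and the final formula\<close>

lemma N_even_ge:
  assumes "r ^ 2 \<le> s + 1"
  shows "N_even s \<ge> 6 * int r - 6"
proof -
  have "real r ^ 2 \<le> real s + 1"
    using assms by (metis of_nat_1 of_nat_add of_nat_le_iff of_nat_power)
  then have "real r \<le> sqrt (real s + 1)" by (rule real_le_rsqrt)
  then have "int r \<le> \<lfloor>sqrt (real s + 1)\<rfloor>" by (simp add: le_floor_iff)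
  then show ?thesis by (simp add: N_even_def)
qed

text \<open>Completing the square: r(r + 1) \<le> s + 1 is equivalent to (2r + 1)^2 \<le> 4s +
  5.\<close>

lemma N_odd_ge:
  assumes "r * (r + 1) \<le> s + 1"
  shows "N_odd s \<ge> 6 * int r - 3"
proof -
  have "real (r * (r + 1)) \<le> real (s + 1)" using assms by (simp only: of_nat_le_iff)
  then have "(2 * real r + 1) ^ 2 \<le> 4 * real s + 5"
    by (simp add: power2_eq_square algebra_simps)
  then have "2 * real r + 1 \<le> sqrt (4 * real s + 5)" by (rule real_le_rsqrt)
  then have "int r \<le> \<lfloor>(sqrt (4 * real s + 5) - 1) / 2\<rfloor>" by (simp add: le_floor_iff)
  then show ?thesis by (simp add: N_odd_def)
qed

theorem theorem2p2:
  fixes s k i n :: nat and xe ye xo yo :: int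
  assumes "s = k * (k + 1) + i" and "i \<le> 2 * k + 1"
    and "(xe, ye) = xy_even k i" and "(xo, yo) = xy_odd k i"
    and "s \<in> {0, 1, 2} \<or> s \<notin> exceptional_set"
    and "n \<ge> 2"
  shows "(even n \<and> int n > N_even s \<longrightarrow>
            real_of_int (gen_frobenius [triangle n, triangle (n + 1), triangle (n + 2)] s) =
              (real n + 1) * (real n + 2) / 4 *
                ((2 * real_of_int xe + real_of_int ye + 3) * real n + 6 * real_of_int xe) - 1)
       \<and> (odd n \<and> int n > N_odd s \<longrightarrow>
            real_of_int (gen_frobenius [triangle n, triangle (n + 1), triangle (n + 2)] s) =
              (real n + 1) * (real n + 2) / 4 *
                ((real_of_int xo + 2 * real_of_int yo + 3) * real n
                  + 3 * (real_of_int xo - 1)) - 1)"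
proof (intro conjI impI)
  assume n: "even n \<and> int n > N_even s"
  then obtain m where m: "n = 2 * m" by (elim conjE evenE)
  have "m > 0" using \<open>n \<ge> 2\<close> m by simp
  have "k ^ 2 \<le> s + 1" using assms(1) by (simp add: power2_eq_square)
  then have lo: "3 * k < m + 3" using n m N_even_ge[of k s] by linarith
  \<comment> \<open>The floor in \<open>N_even\<close> reaches k + 1 exactly at i = k, where s + 1 =
    (k + 1)^2; from there on \<open>a\<close> or the level below w can need 3k \<le> m.\<close>
  have hi: "3 * k < m" if "k \<le> i"
  proof -
    have "(k + 1) ^ 2 \<le> s + 1" using assms(1) that by (simp add: power2_eq_square)
    then show ?thesis using n m N_even_ge[of "k + 1" s] by simp
  qed
  \<comment> \<open>Levels below 2k hold k(k + 1) points, and levels 2k and 2k + 1 hold k + 1 each.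
    So w is the level of the (s + 1)-st point and a its index there.\<close>
  define w a where "w = (if i \<le> k then 2 * k else 2 * k + 1)"
    and "a = (if i \<le> k then i else i - k - 1)"
  have "int w = 2 * xe + ye" "int a = xe"
    using assms(2,3) by (auto simp: xy_even_def w_def a_def)
  then have xy: "xe = int a" "ye = int w - 2 * int a" by simp_all
  have "a \<le> w div 2" "3 * a \<le> m" "3 * ((w - 1) div 2) \<le> m + 3 * a"
    unfolding w_def a_def using assms(2) lo hi by (cases "i < k"; cases "i = k"; simp)+
  moreover have "s = (\<Sum>v<w. v div 2 + 1) + a"
    using assms(1) unfolding w_def a_def by (simp only: sum_level_sizes split: if_split) simp
  ultimately have eq: "gen_frobenius [triangle n, triangle (n + 1), triangle (n + 2)] s =
      (2 * int m + 1) * (int m + 1) * (int m * int w + 3 * int a + 3 * int m) - 1"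
    unfolding m by (intro gen_frobenius_triangle_even \<open>m > 0\<close>)
  show "real_of_int (gen_frobenius [triangle n, triangle (n + 1), triangle (n + 2)] s) =
      (real n + 1) * (real n + 2) / 4 *
        ((2 * real_of_int xe + real_of_int ye + 3) * real n + 6 * real_of_int xe) - 1"
    unfolding eq by (simp add: m xy algebra_simps add_divide_distrib diff_divide_distrib)
next
  assume n: "odd n \<and> int n > N_odd s"
  then obtain m where m: "n = 2 * m + 1" by (elim conjE oddE)
  have "m > 0" using \<open>n \<ge> 2\<close> m by simp
  have "k * (k + 1) \<le> s + 1" using assms(1) by simp
  then have lo: "3 * k \<le> m + 1" using n m N_odd_ge[of k s] by linarith
  \<comment> \<open>At i = 2k + 1 one has s + 1 = (k + 1)(k + 2), so the threshold rises. This is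
    the case a = 0 on level 2k + 1, where level 2k + 2 comes closest.\<close>
  have hi: "3 * k + 2 \<le> m" if "i = 2 * k + 1"
  proof -
    have "(k + 1) * (k + 1 + 1) \<le> s + 1" using assms(1) that by simp
    then show ?thesis using n m N_odd_ge[of "k + 1" s] by simp
  qed
  \<comment> \<open>The level is chosen as for even n, but \<open>a\<close> counts down from k
    because values decrease along a level.\<close>
  define w a where "w = (if i \<le> k then 2 * k else 2 * k + 1)"
    and "a = (if i \<le> k then k - i else 2 * k + 1 - i)"
  have "int w = xo + 2 * yo" "int a = yo"
    using assms(2,4) by (auto simp: xy_odd_def w_def a_def)
  then have xy: "xo = int w - 2 * int a" "yo = int a" by simp_all
  have "a \<le> w div 2" "3 * a \<le> m + 2" "3 * ((w + 1) div 2) \<le> m + 2 + 3 * a"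
    unfolding w_def a_def using assms(2) lo hi by (cases "i \<le> k"; cases "i = 2 * k + 1"; simp)+
  moreover have "s = (\<Sum>v<w. v div 2 + 1) + (w div 2 - a)"
    using assms(1,2) unfolding w_def a_def by (simp only: sum_level_sizes split: if_split) simp
  ultimately have eq: "gen_frobenius [triangle n, triangle (n + 1), triangle (n + 2)] s =
      (int m + 1) * (2 * int m + 3) * ((int m + 2) * int w - 3 * int a + 3 * int m) - 1"
    using gen_frobenius_triangle_odd[OF \<open>m > 0\<close>, of a w s] by (simp add: m)
  show "real_of_int (gen_frobenius [triangle n, triangle (n + 1), triangle (n + 2)] s) =
      (real n + 1) * (real n + 2) / 4 *
        ((real_of_int xo + 2 * real_of_int yo + 3) * real n
          + 3 * (real_of_int xo - 1)) - 1"
    unfolding eq by (simp add: m xy algebra_simps add_divide_distrib diff_divide_distrib)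
qed

end
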